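(* Let $p$ be an odd prime, $n$ a positive integer, and let $f$ be the function on $\mathbb{F}_{p^n}$ defined by $f(0)=1$, $f(1)=0$ and $f(x)=x^{-1}$ for $x\notin\{0,1\}$. Then $\nabla_f=4$ if $p=29$ or $p=37$, and $\nabla_f\le 3$ otherwise. Furthermore, for $a,b\in\mathbb{F}_{p^n}$, $\nabla_f(a,b)=4$ if and only if one of the following holds: (1) $p=29$ and $(a,b)=(\pm2,\pm12)$ or $(a,b)=(\pm12,\pm2)$; (2) $p=37$ and $(a,b)=(\pm2,\pm6)$ or $(a,b)=(\pm6,\pm2)$.
   Context: For $a,b\in\mathbb{F}_{p^n}$, $\nabla_f(a,b)$ is the number of $x\in\mathbb{F}_{p^n}$ with $f(x+a+b)-f(x+a)-f(x+b)+f(x)=0$. For odd $p$ the second-order zero differential uniformity is $\nabla_f=\max\{\nabla_f(a,b): a,b\in\mathbb{F}_{p^n}\setminus\{0\}\}$. The function $f$ is $Inv\circ(0,1)$ with $Inv(x)=x^{p^n-2}$ and $(0,1)$ the transposition swapping $0$ and $1$. Integers such as $\pm2,\pm6,\pm12$ denote the corresponding elements of the prime field $\mathbb{F}_p\subseteq\mathbb{F}_{p^n}$. *)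

theory Defs
  imports Main "HOL-Computational_Algebra.Primes"
begin

text \<open>Inv(x) = x^(q-2) on a finite field coincides with HOL's inverse (inverse 0 = 0).
  The function Inv o (0,1): f(0)=1, f(1)=0, f(x)=x^{-1} otherwise.\<close>
definition inv_swap01 :: "'a::field \<Rightarrow> 'a" where
  "inv_swap01 x = (if x = 0 then 1 else if x = 1 then 0 else inverse x)"

definition nabla2 :: "('a::field \<Rightarrow> 'a) \<Rightarrow> 'a \<Rightarrow> 'a \<Rightarrow> nat" where
  "nabla2 f a b = card {x. f (x + a + b) - f (x + a) - f (x + b) + f x = 0}"

text \<open>Second-order zero differential uniformity (odd characteristic).\<close>
definition nabla_unif :: "('a::{field,finite} \<Rightarrow> 'a) \<Rightarrow> nat" where
  "nabla_unif f = Max {nabla2 f a b | a b. a \<noteq> 0 \<and> b \<noteq> 0}"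

end

theory Submission
  imports Defs
begin

text \<open>
  Fix nonzero \<open>a\<close>, \<open>b\<close>.  If none of \<open>x\<close>, \<open>x + a\<close>, \<open>x + b\<close>, \<open>x + a + b\<close> lies in \<open>{0, 1}\<close>, clearing
  denominators turns the equation into \<open>a b (2x + a + b) = 0\<close>, so \<open>x\<close> is the centre \<open>-(a + b)/2\<close>.
  The other candidates are the four translates of \<open>0\<close> and the four translates of \<open>1\<close>; since the
  count is invariant under swapping \<open>a\<close>, \<open>b\<close> and changing their signs, each candidate amounts to
  \<open>0\<close> or \<open>1\<close> being a solution for \<open>(\<plusminus>a, \<plusminus>b)\<close>.  When \<open>a\<close>, \<open>b\<close>, \<open>a \<plusminus> b\<close> avoid \<open>{0, 1, -1}\<close>, at most
  one translate of \<open>0\<close> and at most two translates of \<open>1\<close> are solutions, and two translates of \<open>1\<close>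
  force \<open>a = \<plusminus>2\<close>, \<open>b\<^sup>2 = -1\<close> up to swapping; a solution among the translates of \<open>0\<close> then
  gives \<open>2b = \<plusminus>5\<close> or \<open>6b = \<plusminus>1\<close>, that is \<open>29 = 0\<close> or \<open>37 = 0\<close>.  Up to symmetry the degenerate pairs
  satisfy \<open>a = 1\<close>, \<open>a = b\<close> or \<open>a + b = 1\<close>; there, too many simultaneous solutions would make two
  coprime integers vanish in the field, or would force \<open>b\<close> to be one of finitely many values treated
  by hand.
\<close>

section \<open>Solutions for a fixed pair and their symmetries\<close>

definition zero_set :: "'a::field \<Rightarrow> 'a \<Rightarrow> 'a set" where
  "zero_set a b =
    {x. inv_swap01 (x + a + b) - inv_swap01 (x + a) - inv_swap01 (x + b) + inv_swap01 x = 0}"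

lemma nabla2_eq_card: "nabla2 inv_swap01 a b = card (zero_set a b)"
  by (simp add: nabla2_def zero_set_def)

lemma zero_set_swap: "zero_set b a = zero_set a b"
  by (auto simp: zero_set_def algebra_simps)

text \<open>Moving the base point by \<open>a\<close> exchanges the four terms in pairs and flips
  the overall sign. Every translate of 0 or 1 can thus be treated as 0 or 1 itself, for a
  sign-changed pair.\<close>

lemma shift_left_mem_zero_set_iff: "x - a \<in> zero_set a b \<longleftrightarrow> x \<in> zero_set (- a) b"
proof -
  have "inv_swap01 (x + - a + b) - inv_swap01 (x + - a) - inv_swap01 (x + b) + inv_swap01 x =
    - (inv_swap01 (x - a + a + b) - inv_swap01 (x - a + a) - inv_swap01 (x - a + b) + inv_swap01 (x - a))"
    by (simp add: algebra_simps)
  then show ?thesis by (simp only: zero_set_def mem_Collect_eq neg_equal_0_iff_equal)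
qed

lemma shift_right_mem_zero_set_iff: "x - b \<in> zero_set a b \<longleftrightarrow> x \<in> zero_set a (- b)"
  using shift_left_mem_zero_set_iff[of x b a] by (simp add: zero_set_swap)

lemmas shift_mem_zero_set_iff = shift_left_mem_zero_set_iff shift_right_mem_zero_set_iff

lemma nabla2_swap: "nabla2 inv_swap01 b a = nabla2 inv_swap01 a b"
  by (simp add: nabla2_eq_card zero_set_swap)

lemma nabla2_neg_left: "nabla2 inv_swap01 (- a) b = nabla2 inv_swap01 a b"
proof -
  have "bij_betw (\<lambda>x. x - a) (zero_set (- a) b) (zero_set a b)"
    by (rule bij_betw_byWitness[where f' = "\<lambda>x. x + a"])
      (auto simp flip: shift_left_mem_zero_set_iff)
  then show ?thesis by (simp add: nabla2_eq_card bij_betw_same_card)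
qed

lemma nabla2_neg_right: "nabla2 inv_swap01 a (- b) = nabla2 inv_swap01 a b"
  using nabla2_neg_left[of b a] by (simp add: nabla2_swap)

section \<open>Candidate solutions and criteria for 0 and 1\<close>

lemma inv_swap01_0 [simp]: "inv_swap01 0 = 1"
  and inv_swap01_1 [simp]: "inv_swap01 1 = 0"
  and inv_swap01_inverse: "x \<noteq> 0 \<Longrightarrow> x \<noteq> 1 \<Longrightarrow> inv_swap01 x = inverse x"
  by (simp_all add: inv_swap01_def)

lemma zero_set_subset:
  fixes a b :: "'a::field"
  assumes "(2::'a) \<noteq> 0" "a \<noteq> 0" "b \<noteq> 0"
  shows "zero_set a b \<subseteq>
    {- (a + b) / 2} \<union> {0, 0 - a, 0 - b, 0 - a - b} \<union> {1, 1 - a, 1 - b, 1 - a - b}"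
proof
  fix x assume x: "x \<in> zero_set a b"
  show "x \<in> {- (a + b) / 2} \<union> {0, 0 - a, 0 - b, 0 - a - b} \<union> {1, 1 - a, 1 - b, 1 - a - b}"
  proof (rule ccontr)
    assume "\<not> ?thesis"
    then have ne: "x \<noteq> - (a + b) / 2" "x \<noteq> 0" "x + a \<noteq> 0" "x + b \<noteq> 0" "x + a + b \<noteq> 0"
      "x \<noteq> 1" "x + a \<noteq> 1" "x + b \<noteq> 1" "x + a + b \<noteq> 1"
      by (auto simp: algebra_simps eq_neg_iff_add_eq_0)
    have "inverse (x + a + b) - inverse (x + a) - inverse (x + b) + inverse x = 0"
      using x ne by (simp add: zero_set_def inv_swap01_inverse)
    moreover have "a * b * (2 * x + a + b) =
      (inverse (x + a + b) - inverse (x + a) - inverse (x + b) + inverse x) *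
      (x * (x + a) * (x + b) * (x + a + b))"
      by (simp add: divide_simps ne) algebra
    ultimately have "a * b * (2 * x + a + b) = 0" by simp
    then have "2 * x + a + b = 0" using assms by simp
    then have "x * 2 = - (a + b)" by algebra
    then have "x = - (a + b) / 2" using assms by (simp add: eq_divide_eq)
    with ne show False by simp
  qed
qed

text \<open>The exchanged value \<open>inv_swap01 0 = 1\<close> supplies the constant term; the
  other three arguments avoid 0 and 1 and contribute plain reciprocals. Multiplying by
  \<open>a * b * (a + b)\<close> gives the relation.\<close>

lemma zero_mem_zero_set_iff:
  assumes "a \<noteq> 0" "a \<noteq> 1" "b \<noteq> 0" "b \<noteq> 1" "a + b \<noteq> 0" "a + b \<noteq> 1"
  shows "0 \<in> zero_set a b \<longleftrightarrow> a\<^sup>2 + a * b + b\<^sup>2 = a * b * (a + b)"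
proof -
  have "0 \<in> zero_set a b \<longleftrightarrow> inverse (a + b) - inverse a - inverse b + 1 = 0"
    using assms by (simp add: zero_set_def inv_swap01_inverse)
  also have "\<dots> \<longleftrightarrow> a\<^sup>2 + a * b + b\<^sup>2 = a * b * (a + b)"
    by (simp add: divide_simps assms) algebra
  finally show ?thesis .
qed

text \<open>The term at 1 drops out because \<open>inv_swap01 1 = 0\<close>. Only three reciprocals
  remain, so clearing denominators leaves a quadratic relation.\<close>

lemma one_mem_zero_set_iff:
  assumes "a \<noteq> 0" "a \<noteq> - 1" "b \<noteq> 0" "b \<noteq> - 1" "a + b \<noteq> 0" "a + b \<noteq> - 1"
  shows "1 \<in> zero_set a b \<longleftrightarrow> a\<^sup>2 + a * b + b\<^sup>2 + 2 * (a + b) + 1 = 0"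
proof -
  have ne: "1 + a \<noteq> 0" "1 + b \<noteq> 0" "1 + a + b \<noteq> 0" "1 + a + b \<noteq> 1"
    using assms by (auto simp: add_eq_0_iff add.assoc)
  then have "1 \<in> zero_set a b \<longleftrightarrow> inverse (1 + a + b) - inverse (1 + a) - inverse (1 + b) = 0"
    using assms by (simp add: zero_set_def inv_swap01_inverse)
  also have "\<dots> \<longleftrightarrow> a\<^sup>2 + a * b + b\<^sup>2 + 2 * (a + b) + 1 = 0"
    by (simp add: divide_simps ne) algebra
  finally show ?thesis .
qed


section \<open>The exceptional pairs\<close>

text \<open>The characteristic is expressed by 29 or 37 vanishing, so that the case analysis can run
  over an arbitrary field in which 2 is nonzero.\<close>

definition exceptional :: "'a::field \<Rightarrow> 'a \<Rightarrow> bool" where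
  "exceptional a b \<longleftrightarrow>
     (29 :: 'a) = 0 \<and> ((a = 2 \<or> a = - 2) \<and> (b = 12 \<or> b = - 12) \<or>
                      (a = 12 \<or> a = - 12) \<and> (b = 2 \<or> b = - 2)) \<or>
     (37 :: 'a) = 0 \<and> ((a = 2 \<or> a = - 2) \<and> (b = 6 \<or> b = - 6) \<or>
                      (a = 6 \<or> a = - 6) \<and> (b = 2 \<or> b = - 2))"

lemma exceptional_swap: "exceptional b a \<longleftrightarrow> exceptional a b"
  by (auto simp: exceptional_def)

lemma exceptional_neg_left: "exceptional (- a) b \<longleftrightarrow> exceptional a b"
proof -
  have "- a = k \<longleftrightarrow> a = - k" for k by (metis minus_minus)
  then show ?thesis unfolding exceptional_def by (simp only: minus_minus) blast
qed

lemma exceptional_neg_right: "exceptional a (- b) \<longleftrightarrow> exceptional a b"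
  using exceptional_neg_left[of b a] by (simp only: exceptional_swap)

text \<open>Meant for \<open>simp only\<close>: numerals stay as written, so that facts such as
  \<open>29 = 0\<close> can rewrite them inside an explicit combination.\<close>

lemmas zero_simps = mult_zero_left mult_zero_right add_0_left add_0_right diff_0_right

text \<open>Replacing \<open>c * c\<close> by -1 makes the two equations linear:
  \<open>2 * c = 5\<close> or \<open>6 * c = 1\<close>. Squaring gives \<open>29 = 0\<close> or
  \<open>37 = 0\<close>, and then \<open>c = - 12\<close> or \<open>c = - 6\<close>.\<close>

lemma exceptional_2:
  fixes c :: "'a::field"
  assumes two: "(2::'a) \<noteq> 0" and c: "c * c + 1 = 0"
    and eqs: "4 + 2 * c + c * c - 2 * c * (2 + c) = 0 \<or> 4 - 2 * c + c * c - 2 * c * (2 - c) = 0"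
  shows "exceptional 2 c"
  using eqs
proof
  assume eq: "4 + 2 * c + c * c - 2 * c * (2 + c) = 0"
  have "5 - 2 * c = (c * c + 1) + (4 + 2 * c + c * c - 2 * c * (2 + c))" by algebra
  then have c5: "5 - 2 * c = 0" by (simp only: c eq zero_simps)
  have "(29::'a) = (5 - 2 * c) * (5 + 2 * c) + 4 * (c * c + 1)" by algebra
  then have 29: "(29::'a) = 0" by (simp only: c c5 zero_simps)
  have "2 * (c + 12) = 29 - (5 - 2 * c)" by algebra
  then have "2 * (c + 12) = 0" by (simp only: c5 29 zero_simps)
  then have "c + 12 = 0" using two by (simp only: mult_eq_0_iff simp_thms)
  then show ?thesis using 29 by (simp add: exceptional_def eq_neg_iff_add_eq_0)
next
  assume eq: "4 - 2 * c + c * c - 2 * c * (2 - c) = 0"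
  have "1 - 6 * c = (4 - 2 * c + c * c - 2 * c * (2 - c)) - 3 * (c * c + 1)" by algebra
  then have c6: "1 - 6 * c = 0" by (simp only: c eq zero_simps)
  have "(37::'a) = (1 - 6 * c) * (1 + 6 * c) + 36 * (c * c + 1)" by algebra
  then have 37: "(37::'a) = 0" by (simp only: c c6 zero_simps)
  have "c + 6 = c * 37 + 6 * (1 - 6 * c)" by algebra
  then have "c + 6 = 0" by (simp only: c6 37 zero_simps)
  then show ?thesis using 37 by (simp add: exceptional_def eq_neg_iff_add_eq_0)
qed

text \<open>The four equations are the conditions for the translates of 0. Changing the sign of
  \<open>a\<close> or \<open>b\<close> permutes them, which reduces everything to
  \<open>a = 2\<close> and the two equations of \<open>exceptional_2\<close>.\<close>

lemma generic_exceptional: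
  fixes a b :: "'a::field"
  assumes two: "(2::'a) \<noteq> 0" and a: "a = 2 \<or> a = - 2" and b: "b * b = - 1"
    and eqs: "a * a + a * b + b * b = a * b * (a + b) \<or> a * a - a * b + b * b = a * b * (a - b) \<or>
      a * a - a * b + b * b = - (a * b * (a - b)) \<or> a * a + a * b + b * b = - (a * b * (a + b))"
  shows "exceptional a b"
proof -
  have "\<exists>c\<in>{b, - b}. 4 + 2 * c + c * c - 2 * c * (2 + c) = 0 \<or>
      4 - 2 * c + c * c - 2 * c * (2 - c) = 0"
    using a eqs by (elim disjE) (simp_all add: algebra_simps eq_neg_iff_add_eq_0)
  then obtain c where c: "c = b \<or> c = - b"
    and "4 + 2 * c + c * c - 2 * c * (2 + c) = 0 \<or> 4 - 2 * c + c * c - 2 * c * (2 - c) = 0"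
    by blast
  moreover from b c have "c * c + 1 = 0" by auto
  ultimately have "exceptional 2 c" using exceptional_2[OF two] by blast
  then show ?thesis using a c exceptional_neg_left[of 2 b] exceptional_neg_right[of 2 b] by auto
qed

section \<open>Generic pairs\<close>

lemma neg_notin_0_1_neg1:
  fixes x :: "'a::field"
  assumes "x \<noteq> 0" "x \<noteq> 1" "x \<noteq> - 1"
  shows "- x \<noteq> 0" "- x \<noteq> 1" "- x \<noteq> - 1"
  using assms by (auto simp: minus_equation_iff[of x])

lemma card_le_1I: "finite A \<Longrightarrow> (\<And>x y. x \<in> A \<Longrightarrow> y \<in> A \<Longrightarrow> x = y) \<Longrightarrow> card A \<le> 1"
  by (simp add: card_le_Suc0_iff_eq)

lemma nabla2_generic:
  fixes a b :: "'a::field"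
  assumes two: "(2::'a) \<noteq> 0"
    and a: "a \<noteq> 0" "a \<noteq> 1" "a \<noteq> - 1" and b: "b \<noteq> 0" "b \<noteq> 1" "b \<noteq> - 1"
    and s: "a + b \<noteq> 0" "a + b \<noteq> 1" "a + b \<noteq> - 1"
    and d: "a - b \<noteq> 0" "a - b \<noteq> 1" "a - b \<noteq> - 1"
  shows "nabla2 inv_swap01 a b \<le> 3 \<or> nabla2 inv_swap01 a b = 4 \<and> exceptional a b"
proof -
  let ?Z = "zero_set a b"
  note n = neg_notin_0_1_neg1[OF a] neg_notin_0_1_neg1[OF b]
  have s': "- a - b \<noteq> 0" "- a - b \<noteq> 1" "- a - b \<noteq> - 1"
    using neg_notin_0_1_neg1[OF s] by simp_all
  have d': "b - a \<noteq> 0" "b - a \<noteq> 1" "b - a \<noteq> - 1"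
    using neg_notin_0_1_neg1[OF d] by simp_all
  \<comment> \<open>The relations \<open>m0\<close> to \<open>m3\<close> belong to the translates of
    0, and \<open>n0\<close> to \<open>n3\<close> to those of 1. Each is a criterion above, applied
    after shifting to a sign-changed pair.\<close>
  have m0: "a * a + a * b + b * b = a * b * (a + b)" if "0 \<in> ?Z"
    using that zero_mem_zero_set_iff[of a b] a b s by (simp add: power2_eq_square)
  have m1: "a * a - a * b + b * b = a * b * (a - b)" if "0 - a \<in> ?Z"
    using that zero_mem_zero_set_iff[of "- a" b] a b d' n unfolding shift_mem_zero_set_iff
    by (simp add: power2_eq_square algebra_simps)
  have m2: "a * a - a * b + b * b = - (a * b * (a - b))" if "0 - b \<in> ?Z"
    using that zero_mem_zero_set_iff[of a "- b"] a b d n unfolding shift_mem_zero_set_iff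
    by (simp add: power2_eq_square algebra_simps)
  have m3: "a * a + a * b + b * b = - (a * b * (a + b))" if "0 - a - b \<in> ?Z"
    using that zero_mem_zero_set_iff[of "- a" "- b"] a b s' n unfolding shift_mem_zero_set_iff
    by (simp add: power2_eq_square algebra_simps)
  have n0: "a * a + a * b + b * b + 2 * (a + b) + 1 = 0" if "1 \<in> ?Z"
    using that one_mem_zero_set_iff[of a b] a b s by (simp add: power2_eq_square)
  have n1: "a * a - a * b + b * b - 2 * (a - b) + 1 = 0" if "1 - a \<in> ?Z"
    using that one_mem_zero_set_iff[of "- a" b] a b d' n unfolding shift_mem_zero_set_iff
    by (simp add: power2_eq_square algebra_simps)
  have n2: "a * a - a * b + b * b + 2 * (a - b) + 1 = 0" if "1 - b \<in> ?Z"
    using that one_mem_zero_set_iff[of a "- b"] a b d n unfolding shift_mem_zero_set_iff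
    by (simp add: power2_eq_square algebra_simps)
  have n3: "a * a + a * b + b * b - 2 * (a + b) + 1 = 0" if "1 - a - b \<in> ?Z"
    using that one_mem_zero_set_iff[of "- a" "- b"] a b s' n unfolding shift_mem_zero_set_iff
    by (simp add: power2_eq_square algebra_simps)
  \<comment> \<open>All four translates of 0 exclude one another. Among the translates of 1 only
    opposite ones do, hence two classes \<open>E1\<close> and \<open>E2\<close>.\<close>
  define E0 where "E0 = ?Z \<inter> {0, 0 - a, 0 - b, 0 - a - b}"
  define E1 where "E1 = ?Z \<inter> {1, 1 - a - b}"
  define E2 where "E2 = ?Z \<inter> {1 - a, 1 - b}"
  \<comment> \<open>These are the values, up to sign, that two simultaneous relations of the same
    class would force to vanish.\<close>
  have nz: "2 * (a * b * (a + b)) \<noteq> 0" "2 * (a * b * (a - b)) \<noteq> 0"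
    "2 * (a * b * (a - 1)) \<noteq> 0" "2 * (a * b * (a + 1)) \<noteq> 0"
    "2 * (a * b * (b - 1)) \<noteq> 0" "2 * (a * b * (b + 1)) \<noteq> 0"
    using two a b s d by (simp_all add: eq_neg_iff_add_eq_0)
  have nz': "2 * (2 * (a + b)) \<noteq> 0" "2 * (2 * (a - b)) \<noteq> 0"
    using two s d by (simp_all only: mult_eq_0_iff simp_thms)
  have x01: "\<not> (0 \<in> ?Z \<and> 0 - a \<in> ?Z)"
  proof
    assume "0 \<in> ?Z \<and> 0 - a \<in> ?Z"
    then have "0 \<in> ?Z" "0 - a \<in> ?Z" by auto
    from m0[OF this(1)] m1[OF this(2)] have "2 * (a * b * (b - 1)) = 0" by algebra
    then show False using nz nz' by blast
  qed
  have x02: "\<not> (0 \<in> ?Z \<and> 0 - b \<in> ?Z)"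
  proof
    assume "0 \<in> ?Z \<and> 0 - b \<in> ?Z"
    then have "0 \<in> ?Z" "0 - b \<in> ?Z" by auto
    from m0[OF this(1)] m2[OF this(2)] have "2 * (a * b * (a - 1)) = 0" by algebra
    then show False using nz nz' by blast
  qed
  have x03: "\<not> (0 \<in> ?Z \<and> 0 - a - b \<in> ?Z)"
  proof
    assume "0 \<in> ?Z \<and> 0 - a - b \<in> ?Z"
    then have "0 \<in> ?Z" "0 - a - b \<in> ?Z" by auto
    from m0[OF this(1)] m3[OF this(2)] have "2 * (a * b * (a + b)) = 0" by algebra
    then show False using nz nz' by blast
  qed
  have x12: "\<not> (0 - a \<in> ?Z \<and> 0 - b \<in> ?Z)"
  proof
    assume "0 - a \<in> ?Z \<and> 0 - b \<in> ?Z"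
    then have "0 - a \<in> ?Z" "0 - b \<in> ?Z" by auto
    from m1[OF this(1)] m2[OF this(2)] have "2 * (a * b * (a - b)) = 0" by algebra
    then show False using nz nz' by blast
  qed
  have x13: "\<not> (0 - a \<in> ?Z \<and> 0 - a - b \<in> ?Z)"
  proof
    assume "0 - a \<in> ?Z \<and> 0 - a - b \<in> ?Z"
    then have "0 - a \<in> ?Z" "0 - a - b \<in> ?Z" by auto
    from m1[OF this(1)] m3[OF this(2)] have "2 * (a * b * (a + 1)) = 0" by algebra
    then show False using nz nz' by blast
  qed
  have x23: "\<not> (0 - b \<in> ?Z \<and> 0 - a - b \<in> ?Z)"
  proof
    assume "0 - b \<in> ?Z \<and> 0 - a - b \<in> ?Z"
    then have "0 - b \<in> ?Z" "0 - a - b \<in> ?Z" by auto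
    from m2[OF this(1)] m3[OF this(2)] have "2 * (a * b * (b + 1)) = 0" by algebra
    then show False using nz nz' by blast
  qed
  have y03: "\<not> (1 \<in> ?Z \<and> 1 - a - b \<in> ?Z)"
  proof
    assume "1 \<in> ?Z \<and> 1 - a - b \<in> ?Z"
    then have "1 \<in> ?Z" "1 - a - b \<in> ?Z" by auto
    from n0[OF this(1)] n3[OF this(2)] have "2 * (2 * (a + b)) = 0" by algebra
    then show False using nz nz' by blast
  qed
  have y12: "\<not> (1 - a \<in> ?Z \<and> 1 - b \<in> ?Z)"
  proof
    assume "1 - a \<in> ?Z \<and> 1 - b \<in> ?Z"
    then have "1 - a \<in> ?Z" "1 - b \<in> ?Z" by auto
    from n1[OF this(1)] n2[OF this(2)] have "2 * (2 * (a - b)) = 0" by algebra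
    then show False using nz nz' by blast
  qed
  have E0: "card E0 \<le> 1"
    by (rule card_le_1I) (use x01 x02 x03 x12 x13 x23 in \<open>unfold E0_def, blast+\<close>)
  have E1: "card E1 \<le> 1"
    by (rule card_le_1I) (use y03 in \<open>unfold E1_def, blast+\<close>)
  have E2: "card E2 \<le> 1"
    by (rule card_le_1I) (use y12 in \<open>unfold E2_def, blast+\<close>)
  have "?Z \<subseteq> {- (a + b) / 2} \<union> (E0 \<union> (E1 \<union> E2))"
    using zero_set_subset[of a b] two a b unfolding E0_def E1_def E2_def by blast
  then have "card ?Z \<le> card ({- (a + b) / 2} \<union> (E0 \<union> (E1 \<union> E2)))"
    by (rule card_mono[rotated]) (simp add: E0_def E1_def E2_def)
  also have "\<dots> \<le> 1 + (card E0 + (card E1 + card E2))"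
    using card_Un_le[of "{- (a + b) / 2}" "E0 \<union> (E1 \<union> E2)"]
      card_Un_le[of E0 "E1 \<union> E2"] card_Un_le[of E1 E2] by simp
  finally have le: "card ?Z \<le> 1 + (card E0 + (card E1 + card E2))" .
  show ?thesis
  proof (cases "card ?Z \<le> 3")
    case False
    \<comment> \<open>The bound is 1 for the centre plus at most 1 per class, so more than three
      solutions require every class to contribute.\<close>
    then have "card ?Z = 4" "E0 \<noteq> {}" "E1 \<noteq> {}" "E2 \<noteq> {}"
      using le E0 E1 E2 by auto
    have eqs: "a * a + a * b + b * b = a * b * (a + b) \<or> a * a - a * b + b * b = a * b * (a - b) \<or>
      a * a - a * b + b * b = - (a * b * (a - b)) \<or> a * a + a * b + b * b = - (a * b * (a + b))"
      using \<open>E0 \<noteq> {}\<close> m0 m1 m2 m3 unfolding E0_def by blast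
    have "(1 \<in> ?Z \<or> 1 - a - b \<in> ?Z) \<and> (1 - a \<in> ?Z \<or> 1 - b \<in> ?Z)"
      using \<open>E1 \<noteq> {}\<close> \<open>E2 \<noteq> {}\<close> unfolding E1_def E2_def by blast
    then consider "1 \<in> ?Z" "1 - a \<in> ?Z" | "1 \<in> ?Z" "1 - b \<in> ?Z"
      | "1 - a - b \<in> ?Z" "1 - a \<in> ?Z" | "1 - a - b \<in> ?Z" "1 - b \<in> ?Z" by blast
    \<comment> \<open>Subtracting the relation of the \<open>E2\<close> solution from that of the
      \<open>E1\<close> solution leaves a product that fixes one entry as 2 or -2. Substituting back
      gives square -1 for the other entry.\<close>
    then have "(a = 2 \<or> a = - 2) \<and> b * b = - 1 \<or> (b = 2 \<or> b = - 2) \<and> a * a = - 1"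
    proof cases
      case 1
      have "2 * (a * (b + 2)) = 0" using n0[OF 1(1)] n1[OF 1(2)] by algebra
      then have "b = - 2" using two a by (simp add: eq_neg_iff_add_eq_0)
      moreover have "a * a = - 1" using n0[OF 1(1)] \<open>b = - 2\<close> by algebra
      ultimately show ?thesis by blast
    next
      case 2
      have "2 * (b * (a + 2)) = 0" using n0[OF 2(1)] n2[OF 2(2)] by algebra
      then have "a = - 2" using two b by (simp add: eq_neg_iff_add_eq_0)
      moreover have "b * b = - 1" using n0[OF 2(1)] \<open>a = - 2\<close> by algebra
      ultimately show ?thesis by blast
    next
      case 3
      have "2 * (b * (a - 2)) = 0" using n3[OF 3(1)] n1[OF 3(2)] by algebra
      then have "a = 2" using two b by simp
      moreover have "b * b = - 1" using n3[OF 3(1)] \<open>a = 2\<close> by algebra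
      ultimately show ?thesis by blast
    next
      case 4
      have "2 * (a * (b - 2)) = 0" using n3[OF 4(1)] n2[OF 4(2)] by algebra
      then have "b = 2" using two a by simp
      moreover have "a * a = - 1" using n3[OF 4(1)] \<open>b = 2\<close> by algebra
      ultimately show ?thesis by blast
    qed
    then have "exceptional a b"
    proof (elim disjE)
      assume "(b = 2 \<or> b = - 2) \<and> a * a = - 1"
      \<comment> \<open>Exchanging \<open>a\<close> and \<open>b\<close> swaps the two middle
        alternatives and fixes the outer ones.\<close>
      moreover have "b * b + b * a + a * a = b * a * (b + a) \<or> b * b - b * a + a * a = b * a * (b - a) \<or>
          b * b - b * a + a * a = - (b * a * (b - a)) \<or> b * b + b * a + a * a = - (b * a * (b + a))"
        using eqs by (elim disjE) (simp_all add: algebra_simps)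
      ultimately have "exceptional b a" using generic_exceptional[of b a] two by blast
      then show ?thesis by (simp add: exceptional_swap)
    qed (use generic_exceptional two eqs in blast)
    then show ?thesis using \<open>card ?Z = 4\<close> by (simp add: nabla2_eq_card)
  qed (simp add: nabla2_eq_card)
qed

section \<open>Pairs with \<open>a = 1\<close>\<close>

lemma card_le_3I:
  assumes "S \<subseteq> {c} \<union> (A \<union> B)" "finite A" "finite B" "card A + card B \<le> 2"
  shows "card S \<le> 3"
proof -
  have "card S \<le> card ({c} \<union> (A \<union> B))" using assms by (intro card_mono) auto
  also have "\<dots> \<le> card {c} + (card A + card B)"
    using card_Un_le[of "{c}" "A \<union> B"] card_Un_le[of A B] by linarith
  finally show ?thesis using assms(4) by simp
qed

text \<open>Comparing numerals through their difference leaves a single numeral whose nonvanishing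
  is to be checked.\<close>

lemma neI: "x - y \<noteq> 0 \<Longrightarrow> x \<noteq> (y::'a::field)"
  by auto

text \<open>The generic criterion fails for \<open>a = 1\<close>: both exchanged points 0 and 1 are
  among the arguments, so the term at \<open>a\<close> is 0 instead of a reciprocal.\<close>

lemma zero_mem_zero_set_1:
  assumes b: "b \<noteq> 0" "b \<noteq> 1" "b \<noteq> - 1" and "0 \<in> zero_set 1 b"
  shows "b * b + b = 1"
proof -
  have ne: "1 + b \<noteq> 0" "1 + b \<noteq> 1" using b by (auto simp: add_eq_0_iff)
  then have "inverse (1 + b) - inverse b + 1 = 0"
    using assms by (simp add: zero_set_def inv_swap01_inverse)
  moreover have "(inverse (1 + b) - inverse b + 1) * (b * (1 + b)) = b * b + b - 1"
    by (simp add: divide_simps b ne) algebra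
  ultimately show ?thesis by simp
qed

text \<open>The arguments at -1 are \<open>b\<close>, 0, \<open>b - 1\<close> and -1. The second and
  the last together contribute the constant -2.\<close>

lemma minus_one_mem_zero_set_1:
  fixes b :: "'a::field"
  assumes two: "(2::'a) \<noteq> 0" and b: "b \<noteq> 0" "b \<noteq> 1" "b \<noteq> 2" and "- 1 \<in> zero_set 1 b"
  shows "2 * b * b - 2 * b + 1 = 0"
proof -
  have ne: "b - 1 \<noteq> 0" "b - 1 \<noteq> 1" "- 1 \<noteq> (1::'a)"
    using b two by (auto simp: algebra_simps eq_neg_iff_add_eq_0)
  have "inv_swap01 (- 1) = (- 1 :: 'a)" using ne by (simp add: inv_swap01_def)
  then have "inverse b - inverse (b - 1) - 2 = 0"
    using assms ne by (simp add: zero_set_def inv_swap01_inverse algebra_simps)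
  moreover have "(inverse b - inverse (b - 1) - 2) * (b * (b - 1)) = - (2 * b * b - 2 * b + 1)"
    by (simp add: divide_simps b ne) algebra
  ultimately show ?thesis by (simp only: mult_zero_left neg_0_equal_iff_equal)
qed

lemma one_mem_zero_set_1:
  fixes b :: "'a::field"
  assumes two: "(2::'a) \<noteq> 0" and b: "b \<noteq> 0" "b \<noteq> - 1" "b \<noteq> - 2" and "1 \<in> zero_set 1 b"
  shows "b * b + 3 * b + 4 = 0"
proof -
  have "2 + b - 1 = 1 + b" by simp
  then have ne: "1 + b \<noteq> 0" "2 + b \<noteq> 0" "2 + b \<noteq> 1"
    using b by (auto simp: eq_neg_iff_add_eq_0 add.commute)
  have "4 + b * 2 = 2 * (2 + b)" by simp
  then have ne': "4 + b * 2 \<noteq> 0" using two ne(2) by (simp only: mult_eq_0_iff simp_thms)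
  have "2 \<noteq> (1::'a)" by (rule neI) simp
  then have "inverse (2 + b) - inverse 2 - inverse (1 + b) = 0"
    using assms ne by (simp add: zero_set_def inv_swap01_inverse)
  moreover have "(inverse (2 + b) - inverse 2 - inverse (1 + b)) * (2 * (1 + b) * (2 + b)) =
      - (b * b + 3 * b + 4)"
    by (simp add: divide_simps two ne ne') algebra
  ultimately show ?thesis by (simp only: mult_zero_left neg_0_equal_iff_equal)
qed

text \<open>The centre coincides with the translate -1, so four candidates remain. In characteristic
  3 two of them coincide; otherwise -1 fails, since the expression there is -3.\<close>

lemma nabla2_1_1:
  assumes two: "(2::'a::field) \<noteq> 0"
  shows "nabla2 inv_swap01 1 (1::'a) \<le> 3"
proof -
  have sub: "zero_set 1 (1::'a) \<subseteq> {- 1, 0, 1, - 2}"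
    using zero_set_subset[of "1::'a" 1] two by auto
  show ?thesis
  proof (cases "(3::'a) = 0")
    case True
    have "- 2 = (1::'a) - 3" by simp
    then have "- 2 = (1::'a)" by (simp only: True diff_0_right)
    then have "zero_set 1 (1::'a) \<subseteq> {- 1} \<union> ({0} \<union> {1})" using sub by auto
    then show ?thesis unfolding nabla2_eq_card by (rule card_le_3I) simp_all
  next
    case False
    have "- 1 \<noteq> (1::'a)" using two by (simp add: eq_neg_iff_add_eq_0)
    then have "- 1 \<notin> zero_set 1 (1::'a)"
      using False by (simp add: zero_set_def inv_swap01_inverse)
    then have "zero_set 1 (1::'a) \<subseteq> {- 2} \<union> ({0} \<union> {1})" using sub by auto
    then show ?thesis unfolding nabla2_eq_card by (rule card_le_3I) simp_all
  qed
qed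

text \<open>Of the six candidates, -1 and -2 fail. The expression is 5/6 at 0 and 13/6 at -3, and 5
  and 13 cannot both vanish.\<close>

lemma nabla2_1_2:
  assumes two: "(2::'a::field) \<noteq> 0" and three: "(3::'a) \<noteq> 0"
  shows "nabla2 inv_swap01 1 (2::'a) \<le> 3"
proof -
  have four: "(4::'a) \<noteq> 0" using two by (metis mult_2 mult_eq_0_iff numeral_Bit0)
  have six: "(6::'a) \<noteq> 0" using two three by (metis mult_eq_0_iff num_double numeral_times_numeral)
  have ne: "- 1 \<noteq> (1::'a)" "- 2 \<noteq> (1::'a)" "- 3 \<noteq> (1::'a)" "2 \<noteq> (1::'a)" "3 \<noteq> (1::'a)"
    by (rule neI, simp add: two three four)+
  have m1: "- 1 \<notin> zero_set 1 (2::'a)"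
  proof
    assume "- 1 \<in> zero_set 1 (2::'a)"
    then have "inverse 2 - 2 = (0::'a)"
      using ne two by (simp add: zero_set_def inv_swap01_inverse)
    then show False using two three by (simp add: divide_simps)
  qed
  have m2: "- 2 \<notin> zero_set 1 (2::'a)"
    using ne two by (simp add: zero_set_def inv_swap01_inverse)
  have m3: "(13::'a) = 0" if "- 3 \<in> zero_set 1 (2::'a)"
  proof -
    have "2 + inverse 2 - inverse 3 = (0::'a)"
      using that ne two three by (simp add: zero_set_def inv_swap01_inverse)
    then show ?thesis using two three six by (simp add: divide_simps)
  qed
  have m0: "(5::'a) = 0" if "0 \<in> zero_set 1 (2::'a)"
  proof -
    have "inverse 3 - inverse 2 + 1 = (0::'a)"
      using that ne two three by (simp add: zero_set_def inv_swap01_inverse)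
    then show ?thesis using two three six by (simp add: divide_simps)
  qed
  have x: "\<not> (- 3 \<in> zero_set 1 (2::'a) \<and> 0 \<in> zero_set 1 (2::'a))"
  proof
    assume "- 3 \<in> zero_set 1 (2::'a) \<and> 0 \<in> zero_set 1 (2::'a)"
    moreover have "(1::'a) = 2 * 13 - 5 * 5" by simp
    ultimately have "(1::'a) = 0" using m0 m3 by (simp only: zero_simps)
    then show False by simp
  qed
  have "zero_set 1 (2::'a) \<subseteq> {- 3 / 2} \<union> (zero_set 1 2 \<inter> {- 3, 0} \<union> {1})"
  proof
    fix x :: 'a assume "x \<in> zero_set 1 2"
    moreover then have "x \<in> {- 3 / 2, 0, - 1, - 2, - 3, 1}"
      using zero_set_subset[of "1::'a" 2] two by auto
    ultimately show "x \<in> {- 3 / 2} \<union> (zero_set 1 2 \<inter> {- 3, 0} \<union> {1})"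
      using m1 m2 by auto
  qed
  then show ?thesis unfolding nabla2_eq_card
  proof (rule card_le_3I)
    have "card (zero_set 1 2 \<inter> {- 3, 0 :: 'a}) \<le> 1"
      by (rule card_le_1I) (use x in \<open>blast+\<close>)
    then show "card (zero_set 1 2 \<inter> {- 3, 0 :: 'a}) + card {1 :: 'a} \<le> 2" by simp
  qed simp_all
qed

text \<open>Eliminating the square gives \<open>4 * b = 3\<close>, and substituting back gives
  \<open>5 = 0\<close>; modulo 5 the quotient 3/4 is 2. This keeps 0 and -1 from being solutions
  together once \<open>b\<close> differs from 2.\<close>

lemma eq_2_of_two_quadratics:
  fixes b :: "'a::field"
  assumes "b * b + b = 1" "2 * b * b - 2 * b + 1 = 0"
  shows "b = 2"
proof -
  have h: "b * b + b - 1 = 0" "2 * b * b - 2 * b + 1 = 0" using assms by simp_all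
  have "3 - 4 * b = (2 * b * b - 2 * b + 1) - 2 * (b * b + b - 1)" by algebra
  then have b: "3 - 4 * b = 0" by (simp only: h zero_simps)
  have "(5::'a) = 16 * (b * b + b - 1) + (3 - 4 * b) * (4 * b + 7)" by algebra
  then have 5: "(5::'a) = 0" by (simp only: h b zero_simps)
  have "b - 2 = 5 * (b - 1) + (3 - 4 * b)" by algebra
  then have "b - 2 = 0" by (simp only: 5 b zero_simps)
  then show ?thesis by simp
qed

lemma nabla2_1:
  fixes b :: "'a::field"
  assumes two: "(2::'a) \<noteq> 0" and b: "b \<noteq> 0"
  shows "nabla2 inv_swap01 1 b \<le> 3"
proof -
  \<comment> \<open>The values 2 and -2 are split off because there \<open>b - 1\<close> or
    \<open>b + 2\<close> becomes an exchanged point, which the criteria above exclude.\<close>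
  consider "b = 1" | "b = - 1" | "b \<noteq> 1" "b \<noteq> - 1" "b = 2" | "b \<noteq> 1" "b \<noteq> - 1" "b = - 2"
    | "b \<noteq> 1" "b \<noteq> - 1" "b \<noteq> 2" "b \<noteq> - 2" by blast
  then show ?thesis
  proof cases
    case 1
    then show ?thesis using nabla2_1_1[OF two] by simp
  next
    case 2
    then show ?thesis using nabla2_1_1[OF two] by (simp add: nabla2_neg_right)
  next
    case 3
    then have "(3::'a) \<noteq> 0" by (simp add: eq_neg_iff_add_eq_0)
    then show ?thesis using nabla2_1_2[OF two] 3 by simp
  next
    case 4
    then have "- (3::'a) \<noteq> 0"
    proof -
      have "- 2 - (1::'a) = - 3" by simp
      then show ?thesis using 4 by (metis eq_iff_diff_eq_0)
    qed
    then show ?thesis using nabla2_1_2[OF two] 4 by (simp add: nabla2_neg_right)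
  next
    case 5
    let ?Z = "zero_set 1 b"
    have nb: "- b \<noteq> 0" "- b \<noteq> 1" "- b \<noteq> - 1" "- b \<noteq> 2" "- b \<noteq> - 2"
      using b 5 by (metis minus_minus minus_zero)+
    have e0: "b * b + b = 1" if "0 \<in> ?Z"
      using zero_mem_zero_set_1 b 5 that by blast
    have e0': "b * b - b = 1" if "0 - b \<in> ?Z"
      using zero_mem_zero_set_1[of "- b"] nb that unfolding shift_right_mem_zero_set_iff by simp
    have e1: "2 * b * b - 2 * b + 1 = 0" if "- 1 \<in> ?Z"
      using minus_one_mem_zero_set_1 b 5 two that by blast
    have e1': "2 * b * b + 2 * b + 1 = 0" if "- 1 - b \<in> ?Z"
      using minus_one_mem_zero_set_1[of "- b"] nb two that
      unfolding shift_right_mem_zero_set_iff by simp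
    have e2: "b * b + 3 * b + 4 = 0" if "1 \<in> ?Z"
      using one_mem_zero_set_1 b 5 two that by blast
    have e2': "b * b - 3 * b + 4 = 0" if "1 - b \<in> ?Z"
      using one_mem_zero_set_1[of "- b"] nb two that
      unfolding shift_right_mem_zero_set_iff by simp
    have sub: "?Z \<subseteq> {- (1 + b) / 2} \<union> {0, 0 - b, - 1, - 1 - b, 1, 1 - b}"
      using zero_set_subset[of 1 b] two b by auto
    have x00: "\<not> (0 \<in> ?Z \<and> 0 - b \<in> ?Z)"
    proof
      assume "0 \<in> ?Z \<and> 0 - b \<in> ?Z"
      then have "0 \<in> ?Z" "0 - b \<in> ?Z" by auto
      note h = e0[OF this(1)] e0'[OF this(2)]
      have "2 * b = (b * b + b) - (b * b - b)" by algebra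
      then have "2 * b = 0" by (simp only: h diff_self)
      then show False using two b by simp
    qed
    have x11: "\<not> (- 1 \<in> ?Z \<and> - 1 - b \<in> ?Z)"
    proof
      assume "- 1 \<in> ?Z \<and> - 1 - b \<in> ?Z"
      then have "- 1 \<in> ?Z" "- 1 - b \<in> ?Z" by auto
      note h = e1[OF this(1)] e1'[OF this(2)]
      have "2 * (2 * b) = (2 * b * b + 2 * b + 1) - (2 * b * b - 2 * b + 1)" by algebra
      then have "2 * (2 * b) = 0" by (simp only: h diff_self)
      then show False using two b by (simp only: mult_eq_0_iff simp_thms)
    qed
    define A where "A = ?Z \<inter> {0, 0 - b}"
    define B where "B = ?Z \<inter> {- 1, - 1 - b}"
    define C where "C = ?Z \<inter> {1, 1 - b}"
    have fin: "finite A" "finite B" "finite C" by (simp_all add: A_def B_def C_def)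
    have A: "card A \<le> 1" by (rule card_le_1I[OF fin(1)]) (use x00 in \<open>unfold A_def, blast\<close>)
    have B: "card B \<le> 1" by (rule card_le_1I[OF fin(2)]) (use x11 in \<open>unfold B_def, blast\<close>)
    have subABC: "?Z \<subseteq> {- (1 + b) / 2} \<union> ((A \<union> B) \<union> C)"
      using sub unfolding A_def B_def C_def by blast
    show ?thesis
    \<comment> \<open>In characteristic 3 the conditions for 1 and \<open>1 - b\<close> both read
      \<open>b * b = - 1\<close>, so \<open>C\<close> may have two elements; but then
      \<open>A\<close> and \<open>B\<close> are empty. Otherwise \<open>C\<close> has at most one
      element, and \<open>A\<close> or \<open>B\<close> is empty.\<close>
    proof (cases "(3::'a) = 0")
      case True
      show ?thesis
      proof (cases "C = {}")
        case True
        then show ?thesis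
          unfolding nabla2_eq_card
          using card_le_3I[of ?Z "- (1 + b) / 2" A B] subABC A B fin by simp
      next
        case False
        have four: "(4::'a) = 1" using \<open>(3::'a) = 0\<close> by (metis add.left_neutral numeral_plus_one semiring_norm(2,8))
        have bb: "b * b = - 1"
          using False e2 e2' True unfolding C_def
          by (auto simp: four eq_neg_iff_add_eq_0)
        then have bb': "b * b + 1 = 0" by simp
        have "A = {}"
        proof (rule ccontr)
          assume "A \<noteq> {}"
          then consider "b * b + b = 1" | "b * b - b = 1" using e0 e0' unfolding A_def by blast
          then show False
          proof cases
            case 1
            moreover have "b - 2 = (b * b + b) - 1 - (b * b + 1)" by algebra
            ultimately show False using 5 bb by simp
          next
            case 2
            moreover have "- b - 2 = (b * b - b) - 1 - (b * b + 1)" by algebra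
            ultimately show False using nb bb by simp
          qed
        qed
        moreover have "B = {}"
        proof (rule ccontr)
          assume "B \<noteq> {}"
          then consider "2 * b * b - 2 * b + 1 = 0" | "2 * b * b + 2 * b + 1 = 0"
            using e1 e1' unfolding B_def by blast
          then show False
          proof cases
            case 1
            have "b - 1 = 3 * b + (2 * b * b - 2 * b + 1) - 2 * (b * b + 1)" by algebra
            then have "b - 1 = 0" by (simp only: True 1 bb' zero_simps)
            then show False using 5 by simp
          next
            case 2
            have "- b - 1 = 3 * - b + (2 * b * b + 2 * b + 1) - 2 * (b * b + 1)" by algebra
            then have "- b - 1 = 0" by (simp only: True 2 bb' zero_simps)
            then show False using nb by simp
          qed
        qed
        ultimately have "?Z \<subseteq> {- (1 + b) / 2} \<union> ({1} \<union> {1 - b})"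
          using subABC unfolding C_def by blast
        then show ?thesis unfolding nabla2_eq_card by (rule card_le_3I) simp_all
      qed
    next
      case three: False
      \<comment> \<open>Combinations with equal shifts force \<open>b\<close> to be 2 or -2; the
        crossed ones force \<open>3 = 0\<close>.\<close>
      have x0: "A = {} \<or> B = {}"
      proof (rule ccontr)
        assume "\<not> (A = {} \<or> B = {})"
        then consider "0 \<in> ?Z" "- 1 \<in> ?Z" | "0 \<in> ?Z" "- 1 - b \<in> ?Z"
          | "0 - b \<in> ?Z" "- 1 \<in> ?Z" | "0 - b \<in> ?Z" "- 1 - b \<in> ?Z"
          unfolding A_def B_def by blast
        then show False
        proof cases
          case 1
          show False using eq_2_of_two_quadratics[of b] e0[OF 1(1)] e1[OF 1(2)] 5 by simp
        next
          case 2
          have "(3::'a) = (2 * b * b + 2 * b + 1) - 2 * (b * b + b) + 2" by algebra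
          then have "(3::'a) = 0" by (simp only: e0[OF 2(1)] e1'[OF 2(2)]) simp
          then show False using three by contradiction
        next
          case 3
          have "(3::'a) = (2 * b * b - 2 * b + 1) - 2 * (b * b - b) + 2" by algebra
          then have "(3::'a) = 0" by (simp only: e0'[OF 3(1)] e1[OF 3(2)]) simp
          then show False using three by contradiction
        next
          case 4
          show False using eq_2_of_two_quadratics[of "- b"] e0'[OF 4(1)] e1'[OF 4(2)] nb by simp
        qed
      qed
      have "\<not> (1 \<in> ?Z \<and> 1 - b \<in> ?Z)"
      proof
        assume "1 \<in> ?Z \<and> 1 - b \<in> ?Z"
        then have "1 \<in> ?Z" "1 - b \<in> ?Z" by auto
        note h = e2[OF this(1)] e2'[OF this(2)]
        have "2 * (3 * b) = (b * b + 3 * b + 4) - (b * b - 3 * b + 4)" by algebra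
        then have "2 * (3 * b) = 0" by (simp only: h diff_self)
        then show False using two three b by (simp only: mult_eq_0_iff simp_thms)
      qed
      then have C: "card C \<le> 1"
        by (intro card_le_1I[OF fin(3)]) (unfold C_def, blast)
      have "card (A \<union> B) + card C \<le> 2" using x0 A B C by auto
      then show ?thesis
        unfolding nabla2_eq_card using card_le_3I[OF subABC] fin by simp
    qed
  qed
qed

section \<open>Pairs with \<open>a = b\<close>\<close>

text \<open>If \<open>2 * a = 1\<close>, the argument \<open>a + a\<close> is an exchanged point and
  the equation gives \<open>a = 2\<close>, hence the excluded \<open>a = - 1\<close>. Otherwise
  clearing denominators suffices.\<close>

lemma zero_mem_zero_set_same:
  fixes a :: "'a::field"
  assumes two: "(2::'a) \<noteq> 0" and a: "a \<noteq> 0" "a \<noteq> 1" "a \<noteq> - 1" and mem: "0 \<in> zero_set a a"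
  shows "2 * a = 3"
proof (cases "2 * a = 1")
  case True
  then have "a + a = 1" by simp
  then have "1 - 2 * inverse a = 0" using mem a by (simp add: zero_set_def inv_swap01_inverse)
  moreover have "a - 2 = (1 - 2 * inverse a) * a" using a by (simp add: field_simps)
  ultimately have a2: "a - 2 = 0" by simp
  have "a + 1 = 2 * a - 1 - (a - 2)" by algebra
  then have "a + 1 = 0" by (simp only: a2 True diff_self)
  then show ?thesis using a by (simp add: eq_neg_iff_add_eq_0)
next
  case False
  then have ne: "a + a \<noteq> 0" "a + a \<noteq> 1" using two a by (simp_all flip: mult_2)
  have "inverse (a + a) - inverse a - inverse a + 1 = 0"
    using mem a ne by (simp add: zero_set_def inv_swap01_inverse)
  moreover have "(inverse (a + a) - inverse a - inverse a + 1) * (a + a) = 2 * a - 3"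
    using a ne two by (simp add: field_simps)
  ultimately show ?thesis by simp
qed

text \<open>When \<open>1 + a + a\<close> is 0 its value is 1, which would force the excluded
  \<open>a = 1\<close>.\<close>

lemma one_mem_zero_set_same:
  fixes a :: "'a::field"
  assumes two: "(2::'a) \<noteq> 0" and a: "a \<noteq> 0" "a \<noteq> 1" "a \<noteq> - 1" and mem: "1 \<in> zero_set a a"
  shows "3 * a + 1 = 0"
proof -
  have ne: "1 + a \<noteq> 0" "1 + a \<noteq> 1" using a by (auto simp: add_eq_0_iff)
  have ne': "1 + a + a \<noteq> 1" using two a by (simp add: add.assoc flip: mult_2)
  show ?thesis
  proof (cases "1 + a + a = 0")
    case True
    then have "1 - 2 * inverse (1 + a) = 0"
      using mem ne a by (simp add: zero_set_def inv_swap01_inverse)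
    moreover have "a - 1 = (1 - 2 * inverse (1 + a)) * (1 + a)" using ne by (simp add: field_simps)
    ultimately show ?thesis using a by simp
  next
    case False
    then have "inverse (1 + a + a) - inverse (1 + a) - inverse (1 + a) = 0"
      using mem ne ne' a by (simp add: zero_set_def inv_swap01_inverse)
    moreover have "- (3 * a + 1) =
        (inverse (1 + a + a) - inverse (1 + a) - inverse (1 + a)) * ((1 + a) * (1 + a + a))"
      using False by (simp add: divide_simps ne)
    ultimately show ?thesis by (simp only: mult_zero_left neg_equal_0_iff_equal)
  qed
qed

text \<open>The middle translates fail: at \<open>- a\<close> the reciprocals cancel and leave -2,
  at \<open>1 - a\<close> they add up to a fraction with numerator 2. The outer translates of 0
  exclude each other, and so do those of 1.\<close>

lemma nabla2_same:
  fixes a :: "'a::field"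
  assumes two: "(2::'a) \<noteq> 0" and a: "a \<noteq> 0" "a \<noteq> 1" "a \<noteq> - 1"
  shows "nabla2 inv_swap01 a a \<le> 3"
proof -
  let ?Z = "zero_set a a"
  note na = neg_notin_0_1_neg1[OF a]
  have ne: "1 + a \<noteq> 0" "1 + a \<noteq> 1" "1 - a \<noteq> 0" "1 - a \<noteq> 1" using a by (auto simp: add_eq_0_iff)
  have m1: "- a \<notin> ?Z"
    using two a na by (simp add: zero_set_def inv_swap01_inverse)
  have m2: "1 - a \<notin> ?Z"
  proof
    assume "1 - a \<in> ?Z"
    then have "inverse (1 + a) + inverse (1 - a) = 0"
      using ne by (simp add: zero_set_def inv_swap01_inverse add.commute[of a 1])
    moreover have "2 = (inverse (1 + a) + inverse (1 - a)) * ((1 + a) * (1 - a))"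
      by (simp add: divide_simps ne a)
    ultimately show False using two by simp
  qed
  have z: "2 * a = 3" if "0 \<in> ?Z" using zero_mem_zero_set_same two a that by blast
  have z': "2 * - a = 3" if "0 - a - a \<in> ?Z"
    using that zero_mem_zero_set_same[OF two na] unfolding shift_mem_zero_set_iff by blast
  have e: "3 * a + 1 = 0" if "1 \<in> ?Z" using one_mem_zero_set_same two a that by blast
  have e': "3 * - a + 1 = 0" if "1 - a - a \<in> ?Z"
    using that one_mem_zero_set_same[OF two na] unfolding shift_mem_zero_set_iff by blast
  have x: "\<not> (0 \<in> ?Z \<and> 0 - a - a \<in> ?Z)"
  proof
    assume "0 \<in> ?Z \<and> 0 - a - a \<in> ?Z"
    then have h: "2 * a = 3" "2 * - a = 3" using z z' by auto
    have "2 * (2 * a) = 2 * a - 2 * - a" by simp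
    then have "2 * (2 * a) = 0" by (simp only: h diff_self)
    then show False using two a by (simp only: mult_eq_0_iff simp_thms)
  qed
  have y: "\<not> (1 \<in> ?Z \<and> 1 - a - a \<in> ?Z)"
  proof
    assume "1 \<in> ?Z \<and> 1 - a - a \<in> ?Z"
    then have h: "3 * a + 1 = 0" "3 * - a + 1 = 0" using e e' by auto
    have "2 = (3 * a + 1) + (3 * - a + 1)" by simp
    then have "(2::'a) = 0" by (simp only: h zero_simps)
    then show False using two by contradiction
  qed
  define A where "A = ?Z \<inter> {0, 0 - a - a}"
  define B where "B = ?Z \<inter> {1, 1 - a - a}"
  have fin: "finite A" "finite B" by (simp_all add: A_def B_def)
  have A: "card A \<le> 1" by (rule card_le_1I[OF fin(1)]) (use x in \<open>unfold A_def, blast\<close>)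
  have B: "card B \<le> 1" by (rule card_le_1I[OF fin(2)]) (use y in \<open>unfold B_def, blast\<close>)
  have "?Z \<subseteq> {- (a + a) / 2} \<union> (A \<union> B)"
    using zero_set_subset[OF two a(1) a(1)] m1 m2 unfolding A_def B_def by auto
  then show ?thesis unfolding nabla2_eq_card by (rule card_le_3I) (use fin A B in simp_all)
qed

section \<open>Pairs with \<open>a + b = 1\<close>\<close>

text \<open>Here \<open>a\<close> is the translate \<open>1 - b\<close>, and shifting it by
  \<open>b\<close> meets the exchanged point 1; shifting \<open>- a\<close> by \<open>a\<close>
  meets 0. The second relation uses only \<open>a * b\<close> and \<open>a - b\<close>, ready for
  symmetrization.\<close>

lemma mem_zero_set_sum_1:
  fixes a b :: "'a::field"
  assumes two: "(2::'a) \<noteq> 0" and a: "a \<noteq> 0" "a \<noteq> 1" "a \<noteq> - 1" and b: "b \<noteq> 0" "b \<noteq> 1" "b \<noteq> - 1"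
    and s: "a + b = 1" and d: "a \<noteq> b"
  shows "a \<in> zero_set a b \<Longrightarrow> 3 * a + 1 = 0"
    and "- a \<in> zero_set a b \<Longrightarrow> 1 - 3 * (a * b) = (a - b) * (a * b)"
proof -
  have aab: "2 * a + b = 1 + a" using s by algebra
  have "2 * a \<noteq> 1" using s d by (metis add_left_cancel mult_2)
  then have aa: "a + a \<noteq> 0" "a + a \<noteq> 1" using two a by (simp_all flip: mult_2)
  have ne: "1 + a \<noteq> 0" "1 + a \<noteq> 1" using a by (auto simp: add_eq_0_iff)
  show "3 * a + 1 = 0" if "a \<in> zero_set a b"
  proof -
    have "inverse (1 + a) - inverse (a + a) + inverse a = 0"
      using that a aa ne s by (simp add: zero_set_def inv_swap01_inverse aab)
    moreover have "2 + a * 2 \<noteq> 0"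
      using two ne by (metis distrib_left mult.commute mult_1_right mult_eq_0_iff)
    then have "(inverse (1 + a) - inverse (a + a) + inverse a) * ((1 + a) * (a + a)) = 3 * a + 1"
      by (simp add: divide_simps ne aa a two)
    ultimately show ?thesis by simp
  qed
  have "b - a \<noteq> 1"
  proof
    assume "b - a = 1"
    then have "2 * a = 0" using s by algebra
    then show False using two a by simp
  qed
  then have ba: "b - a \<noteq> 0" "b - a \<noteq> 1" using d by simp_all
  note na = neg_notin_0_1_neg1[OF a]
  show "1 - 3 * (a * b) = (a - b) * (a * b)" if "- a \<in> zero_set a b"
  proof -
    have "inverse b - 1 - inverse (b - a) - inverse a = 0"
      using that a b ba na by (simp add: zero_set_def inv_swap01_inverse)
    moreover have "(a - b) * (b - a) + a * b * (- 1 - (b - a)) =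
        (inverse b - 1 - inverse (b - a) - inverse a) * (a * b * (b - a))"
      by (simp add: divide_simps ba a b d[symmetric]) algebra
    ultimately have "(a - b) * (b - a) + a * b * (- 1 - (b - a)) = 0" by simp
    then show ?thesis using s by algebra
  qed
qed

text \<open>Since \<open>a + b = 1\<close>, symmetric conditions become polynomials in
  \<open>P = a * b\<close>. Each of the classes {0}, {1}, {-a, -b}, {a, b} holds at most one
  solution and imposes one such condition. Three nonempty classes would make coprime integers
  vanish, so at most two are nonempty.\<close>

lemma nabla2_sum_1:
  fixes a b :: "'a::field"
  assumes two: "(2::'a) \<noteq> 0" and a: "a \<noteq> 0" "a \<noteq> 1" "a \<noteq> - 1" and b: "b \<noteq> 0" "b \<noteq> 1" "b \<noteq> - 1"
    and s: "a + b = 1" and d: "a \<noteq> b"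
  shows "nabla2 inv_swap01 a b \<le> 3"
proof -
  let ?Z = "zero_set a b"
  define P where "P = a * b"
  have s': "b + a = 1" using s by (simp add: add.commute)
  have d': "b \<noteq> a" using d by simp
  have zs: "zero_set b a = ?Z" by (rule zero_set_swap)
  note na = neg_notin_0_1_neg1[OF a] and nb = neg_notin_0_1_neg1[OF b]
  have na1: "1 + a \<noteq> 0" "1 + a \<noteq> 1" "1 + b \<noteq> 0" "1 + b \<noteq> 1"
    using a b by (auto simp: add_eq_0_iff)
  have "- 1 \<noteq> (1::'a)" "2 \<noteq> (1::'a)" by (rule neI, simp add: two)+
  note one = this
  have P0: "P = 1" if "0 \<in> ?Z"
  proof -
    have "- inverse a - inverse b + 1 = 0"
      using that a b s by (simp add: zero_set_def inv_swap01_inverse)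
    moreover have "(- inverse a - inverse b + 1) * (a * b) = P - (a + b)"
      unfolding P_def by (simp add: divide_simps a b)
    ultimately show ?thesis using s by simp
  qed
  have P1: "P = 4" if "1 \<in> ?Z"
  proof -
    have s2: "1 + a + b = 2" using s by (simp add: add.assoc)
    have "inverse 2 - inverse (1 + a) - inverse (1 + b) = 0"
      using that a b na1 two one by (simp add: zero_set_def inv_swap01_inverse s2)
    \<comment> \<open>Stated for arbitrary elements, so that afterwards each inverse cancels against
      its own factor.\<close>
    moreover have "(h - u - v) * (2 * (A * B)) = (h * 2) * (A * B) - (u * A) * (2 * B) - (v * B) * (2 * A)"
      for h u v A B :: 'a by (simp add: algebra_simps)
    ultimately have "0 * (2 * ((1 + a) * (1 + b))) =
        (inverse 2 * 2) * ((1 + a) * (1 + b)) - (inverse (1 + a) * (1 + a)) * (2 * (1 + b)) -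
        (inverse (1 + b) * (1 + b)) * (2 * (1 + a))" by metis
    then have h: "(1 + a) * (1 + b) - 2 * (1 + b) - 2 * (1 + a) = 0"
      by (simp only: left_inverse[OF two] left_inverse[OF na1(1)] left_inverse[OF na1(3)] mult_1_left mult_zero_left)
    have "P - 4 = ((1 + a) * (1 + b) - 2 * (1 + b) - 2 * (1 + a)) + (a + b - 1)"
      unfolding P_def by algebra
    then have "P - 4 = 0" by (simp only: h s diff_self add_0_left)
    then show ?thesis by simp
  qed
  \<comment> \<open>At \<open>- a - b = - 1\<close> the values 1 at 0 and -1 at -1 cancel; the
    remaining reciprocals sum to \<open>(a + b) / (a * b)\<close>, which is nonzero.\<close>
  have mm1: "- 1 \<notin> ?Z"
  proof
    assume "- 1 \<in> ?Z"
    moreover have "- 1 + a = - b" "- 1 + b = - a" using s by algebra+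
    ultimately have "inverse b + inverse a = 0"
      using a b na nb one s by (simp add: zero_set_def inv_swap01_inverse)
    moreover have "(inverse b + inverse a) * (a * b) = a + b" by (simp add: divide_simps a b)
    ultimately show False using s by simp
  qed
  note ma = mem_zero_set_sum_1[OF two a b s d]
    and mb = mem_zero_set_sum_1[OF two b a s' d', unfolded zs]
  have PA: "9 * P + 4 = 0" if "a \<in> ?Z \<or> b \<in> ?Z"
  proof -
    \<comment> \<open>The product is symmetric, so it covers both members of the class; it expands
      to \<open>9 * P + 4\<close>.\<close>
    have "(3 * a + 1) * (3 * b + 1) = 0" using that ma(1) mb(1) by auto
    then show ?thesis unfolding P_def using s by algebra
  qed
  have PT: "4 * P ^ 3 + 8 * P\<^sup>2 - 6 * P + 1 = 0" if "- a \<in> ?Z \<or> - b \<in> ?Z"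
  proof -
    \<comment> \<open>The sign depends on which member is a solution. Squaring removes it, and the
      square of \<open>a - b\<close> is \<open>1 - 4 * P\<close>.\<close>
    have "1 - 3 * P = (a - b) * P \<or> 1 - 3 * P = - ((a - b) * P)"
      using that ma(2) mb(2) unfolding P_def by (auto simp: mult.commute[of b a] algebra_simps)
    then have "(1 - 3 * P)\<^sup>2 = ((a - b) * P)\<^sup>2" by (elim disjE) (simp_all only: power2_minus)
    moreover have "(a - b)\<^sup>2 = 1 - 4 * P" unfolding P_def using s by algebra
    ultimately have "(1 - 3 * P)\<^sup>2 = (1 - 4 * P) * P\<^sup>2" by (simp add: power_mult_distrib)
    then show ?thesis by algebra
  qed
  have xA: "\<not> (a \<in> ?Z \<and> b \<in> ?Z)"
  proof
    assume "a \<in> ?Z \<and> b \<in> ?Z"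
    then have h: "3 * a + 1 = 0" "3 * b + 1 = 0" using ma(1) mb(1) by auto
    have "3 * (a - b) = (3 * a + 1) - (3 * b + 1)" by algebra
    then have "3 * (a - b) = 0" by (simp only: h diff_self)
    then have "(3::'a) = 0" using d by simp
    then show False using h by simp
  qed
  have xT: "\<not> (- a \<in> ?Z \<and> - b \<in> ?Z)"
  proof
    assume "- a \<in> ?Z \<and> - b \<in> ?Z"
    then have h: "1 - 3 * (a * b) = (a - b) * (a * b)" "1 - 3 * (b * a) = (b - a) * (b * a)"
      using ma(2) mb(2) by auto
    have "2 * ((a - b) * (a * b)) = (1 - 3 * (a * b) - (b - a) * (b * a)) -
      (1 - 3 * (a * b) - (a - b) * (a * b))" by algebra
    then have "2 * ((a - b) * (a * b)) = 0" using h by (auto simp: mult.commute)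
    then show False using two a b d by simp
  qed
  define A where "A = ?Z \<inter> {0}"
  define B where "B = ?Z \<inter> {1}"
  define C where "C = ?Z \<inter> {- a, - b}"
  define D where "D = ?Z \<inter> {a, b}"
  have fin: "finite A" "finite B" "finite C" "finite D"
    by (simp_all add: A_def B_def C_def D_def)
  have A: "card A \<le> 1" by (rule card_le_1I[OF fin(1)]) (unfold A_def, blast)
  have B: "card B \<le> 1" by (rule card_le_1I[OF fin(2)]) (unfold B_def, blast)
  have C: "card C \<le> 1" by (rule card_le_1I[OF fin(3)]) (use xT in \<open>unfold C_def, blast\<close>)
  have D: "card D \<le> 1" by (rule card_le_1I[OF fin(4)]) (use xA in \<open>unfold D_def, blast\<close>)
  have pA: "P = 1" if "A \<noteq> {}" using that P0 unfolding A_def by blast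
  have pB: "P = 4" if "B \<noteq> {}" using that P1 unfolding B_def by blast
  have pC: "4 * P ^ 3 + 8 * P\<^sup>2 - 6 * P + 1 = 0" if "C \<noteq> {}" using that PT unfolding C_def by blast
  have pD: "9 * P + 4 = 0" if "D \<noteq> {}" using that PA unfolding D_def by blast
  \<comment> \<open>Each integer arises by substituting the value of \<open>P\<close> from one class
    into the condition of the other.\<close>
  have AB: "(3::'a) = 0" if "A \<noteq> {}" "B \<noteq> {}"
    using pA pB that by (metis add_right_cancel numeral_plus_one semiring_norm(2,8) add_0)
  have AC: "(7::'a) = 0" if "A \<noteq> {}" "C \<noteq> {}" using pA pC that by simp
  have AD: "(13::'a) = 0" if "A \<noteq> {}" "D \<noteq> {}" using pA pD that by simp
  have BC: "(361::'a) = 0" if "B \<noteq> {}" "C \<noteq> {}" using pB pC that by simp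
  have BD: "(40::'a) = 0" if "B \<noteq> {}" "D \<noteq> {}" using pB pD that by simp
  have bez: "(1::'a) = 7 - 2 * 3" "(1::'a) = 13 - 4 * 3" "(1::'a) = 2 * 7 - 13" "(1::'a) = 361 - 9 * 40"
    by simp_all
  have t1: "A = {} \<or> B = {} \<or> C = {}"
  proof (rule ccontr)
    assume "\<not> ?thesis"
    then have h: "(3::'a) = 0" "(7::'a) = 0" using AB AC by blast+
    have "(1::'a) = 0" using bez(1) by (simp only: h zero_simps)
    then show False by simp
  qed
  have t2: "A = {} \<or> B = {} \<or> D = {}"
  proof (rule ccontr)
    assume "\<not> ?thesis"
    then have h: "(3::'a) = 0" "(13::'a) = 0" using AB AD by blast+
    have "(1::'a) = 0" using bez(2) by (simp only: h zero_simps)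
    then show False by simp
  qed
  have t3: "A = {} \<or> C = {} \<or> D = {}"
  proof (rule ccontr)
    assume "\<not> ?thesis"
    then have h: "(7::'a) = 0" "(13::'a) = 0" using AC AD by blast+
    have "(1::'a) = 0" using bez(3) by (simp only: h zero_simps)
    then show False by simp
  qed
  have t4: "B = {} \<or> C = {} \<or> D = {}"
  proof (rule ccontr)
    assume "\<not> ?thesis"
    then have h: "(361::'a) = 0" "(40::'a) = 0" using BC BD by blast+
    have "(1::'a) = 0" using bez(4) by (simp only: h zero_simps)
    then show False by simp
  qed
  have "card A + card B + card C + card D \<le> 2" using t1 t2 t3 t4 A B C D by auto
  then have "card (A \<union> B) + card (C \<union> D) \<le> 2"
    using card_Un_le[of A B] card_Un_le[of C D] by linarith
  moreover have "?Z \<subseteq> {- (a + b) / 2} \<union> ((A \<union> B) \<union> (C \<union> D))"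
  proof
    fix x assume x: "x \<in> ?Z"
    moreover have "0 - a - b = - 1" "1 - a = b" "1 - b = a" "1 - a - b = 0" using s by algebra+
    ultimately have "x \<in> {- (a + b) / 2} \<union> {0, - a, - b, - 1} \<union> {1, b, a, 0}"
      using zero_set_subset[OF two a(1) b(1)] by auto
    then show "x \<in> {- (a + b) / 2} \<union> ((A \<union> B) \<union> (C \<union> D))"
      using x mm1 unfolding A_def B_def C_def D_def by blast
  qed
  ultimately show ?thesis
    unfolding nabla2_eq_card by (intro card_le_3I) (use fin in simp_all)
qed

section \<open>All nonzero pairs, reduced by symmetry to the cases above\<close>

lemma nabla2_le_3_or_exceptional:
  fixes a b :: "'a::field"
  assumes two: "(2::'a) \<noteq> 0" and ab: "a \<noteq> 0" "b \<noteq> 0"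
  shows "nabla2 inv_swap01 a b \<le> 3 \<or> nabla2 inv_swap01 a b = 4 \<and> exceptional a b"
proof -
  let ?N = "nabla2 inv_swap01 :: 'a \<Rightarrow> 'a \<Rightarrow> nat"
  have *: "?N x y \<le> 3" if "x = 1 \<or> x = - 1" "y \<noteq> 0" for x y
    using that nabla2_1[OF two, of y] by (auto simp: nabla2_neg_left)
  consider (a) "a = 1 \<or> a = - 1" | (b) "b = 1 \<or> b = - 1"
    | (n) "a \<noteq> 1" "a \<noteq> - 1" "b \<noteq> 1" "b \<noteq> - 1" by blast
  then show ?thesis
  proof cases
    case a
    then show ?thesis using * ab by blast
  next
    case b
    then show ?thesis using *[of b a] ab nabla2_swap[of a b] by simp
  next
    case n
    note na = neg_notin_0_1_neg1[OF ab(1) n(1,2)] and nb = neg_notin_0_1_neg1[OF ab(2) n(3,4)]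
    note a = ab(1) n(1,2) and b = ab(2) n(3,4)
    show ?thesis
    proof (cases "a = b \<or> a = - b")
      case True
      then show ?thesis using nabla2_same[OF two a] nabla2_same[OF two b]
        by (auto simp: nabla2_neg_left)
    next
      case False
      then have d: "a \<noteq> b" "a \<noteq> - b" "- a \<noteq> b" "- a \<noteq> - b" by auto
      consider "a + b = 1" | "a + b = - 1" | "a - b = 1" | "a - b = - 1"
        | "a + b \<noteq> 1" "a + b \<noteq> - 1" "a - b \<noteq> 1" "a - b \<noteq> - 1" by blast
      then show ?thesis
      proof cases
        case 1
        then show ?thesis using nabla2_sum_1[OF two a b] d by blast
      next
        case 2
        moreover have "- a + - b = - (a + b)" by simp
        ultimately have "- a + - b = 1" by (simp only: minus_minus)
        then show ?thesis
          using nabla2_sum_1[OF two na nb] d by (simp add: nabla2_neg_left nabla2_neg_right)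
      next
        case 3
        then have "a + - b = 1" by simp
        then show ?thesis
          using nabla2_sum_1[OF two a nb] d by (simp add: nabla2_neg_right)
      next
        case 4
        moreover have "- a + b = - (a - b)" by simp
        ultimately have "- a + b = 1" by (simp only: minus_minus)
        then show ?thesis
          using nabla2_sum_1[OF two na b] d by (simp add: nabla2_neg_left)
      next
        case 5
        have "a + b \<noteq> 0" "a - b \<noteq> 0" using d by (auto simp: eq_neg_iff_add_eq_0)
        then show ?thesis using nabla2_generic[OF two a b _ 5(1,2) _ 5(3,4)] by blast
      qed
    qed
  qed
qed

section \<open>Characteristic and explicit quadruples of solutions\<close>

lemma numeral_eq_0_iff_CHAR_dvd: "(numeral k :: 'a::field) = 0 \<longleftrightarrow> CHAR('a) dvd numeral k"
  by (metis of_nat_eq_0_iff_char_dvd of_nat_numeral)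

text \<open>Translation by 1 permutes the field, so summing over all elements shows that the
  cardinality vanishes in it. The prime characteristic then divides \<open>p ^ n\<close>.\<close>

lemma CHAR_eq_of_card_eq_prime_power:
  assumes "prime p" "card (UNIV :: 'a::{field,finite} set) = p ^ n"
  shows "CHAR('a) = p"
proof -
  have "prime CHAR('a)"
    by (rule prime_CHAR_semidom) (simp add: finite_imp_CHAR_pos)
  moreover have "(\<Sum>x\<in>UNIV. x + 1) = (\<Sum>x\<in>UNIV. x :: 'a)"
    by (rule sum.reindex_bij_witness[of _ "\<lambda>x. x - 1" "\<lambda>x. x + 1"]) simp_all
  then have "of_nat (p ^ n) = (0 :: 'a)" using assms(2) by (simp add: sum.distrib)
  then have "CHAR('a) dvd p ^ n" by (simp only: of_nat_eq_0_iff_char_dvd)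
  ultimately show ?thesis using assms(1) by (metis prime_dvd_power primes_dvd_imp_eq)
qed

lemma card_ge_4I:
  assumes "finite S" "{u, v, w, x} \<subseteq> S" "distinct [u, v, w, x]"
  shows "4 \<le> card S"
proof -
  have "card {u, v, w, x} = 4" using assms(3) by simp
  then show ?thesis using card_mono[OF assms(1,2)] by simp
qed

lemma nabla2_2_12_char_29:
  assumes "CHAR('a::{field,finite}) = 29"
  shows "4 \<le> nabla2 inv_swap01 (2::'a) 12"
proof -
  note nz = numeral_eq_0_iff_CHAR_dvd[where 'a = 'a, unfolded assms]
  \<comment> \<open>These are all arguments outside {0, 1} at which the function is evaluated for
    the four solutions below.\<close>
  have "- 1 \<noteq> (1::'a)" "2 \<noteq> (1::'a)" "5 \<noteq> (1::'a)" "- 5 \<noteq> (1::'a)" "7 \<noteq> (1::'a)" "- 7 \<noteq> (1::'a)"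
    "- 10 \<noteq> (1::'a)" "11 \<noteq> (1::'a)" "- 11 \<noteq> (1::'a)" "- 12 \<noteq> (1::'a)"
    "13 \<noteq> (1::'a)" "- 13 \<noteq> (1::'a)"
    by (rule neI, simp add: nz)+
  note f = inv_swap01_inverse this nz
  \<comment> \<open>The witnesses are the centre -7, the translates -1 and -13 of 1
    (\<open>1 - a\<close> and \<open>1 - a - b\<close>), and the translate -12 of 0
    (\<open>0 - b\<close>).\<close>
  have "- 7 \<in> zero_set (2::'a) 12"
    by (simp add: zero_set_def f)
  moreover have "- 1 \<in> zero_set (2::'a) 12"
    by (simp add: zero_set_def f divide_simps)
  moreover have "- 13 \<in> zero_set (2::'a) 12"
    by (simp add: zero_set_def f divide_simps)
  moreover have "- 12 \<in> zero_set (2::'a) 12"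
    by (simp add: zero_set_def f divide_simps)
  moreover have "distinct [- 7, - 1, - 13, - 12 :: 'a]"
  proof -
    have "- 7 \<noteq> (- 1::'a)" "- 7 \<noteq> (- 13::'a)" "- 7 \<noteq> (- 12::'a)" "- 1 \<noteq> (- 13::'a)" "- 1 \<noteq> (- 12::'a)" "- 13 \<noteq> (- 12::'a)"
      by (rule neI, simp add: nz)+
    then show ?thesis by auto
  qed
  ultimately show ?thesis unfolding nabla2_eq_card by (intro card_ge_4I[where u = "- 7" and v = "- 1" and w = "- 13" and x = "- 12"]) simp_all
qed

lemma nabla2_2_6_char_37:
  assumes "CHAR('a::{field,finite}) = 37"
  shows "4 \<le> nabla2 inv_swap01 (2::'a) 6"
proof -
  note nz = numeral_eq_0_iff_CHAR_dvd[where 'a = 'a, unfolded assms]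
  have "- 1 \<noteq> (1::'a)" "2 \<noteq> (1::'a)" "- 2 \<noteq> (1::'a)" "4 \<noteq> (1::'a)" "- 4 \<noteq> (1::'a)"
    "5 \<noteq> (1::'a)" "- 5 \<noteq> (1::'a)" "- 6 \<noteq> (1::'a)" "7 \<noteq> (1::'a)" "- 7 \<noteq> (1::'a)" "8 \<noteq> (1::'a)" "- 8 \<noteq> (1::'a)"
    by (rule neI, simp add: nz)+
  note f = inv_swap01_inverse this nz
  \<comment> \<open>As before: the centre, \<open>1 - a\<close>, \<open>1 - a - b\<close>, and this
    time \<open>0 - a - b\<close> as the translate of 0.\<close>
  have "- 4 \<in> zero_set (2::'a) 6"
    by (simp add: zero_set_def f)
  moreover have "- 1 \<in> zero_set (2::'a) 6"
    by (simp add: zero_set_def f divide_simps)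
  moreover have "- 7 \<in> zero_set (2::'a) 6"
    by (simp add: zero_set_def f divide_simps)
  moreover have "- 8 \<in> zero_set (2::'a) 6"
    by (simp add: zero_set_def f divide_simps)
  moreover have "distinct [- 4, - 1, - 7, - 8 :: 'a]"
  proof -
    have "- 4 \<noteq> (- 1::'a)" "- 4 \<noteq> (- 7::'a)" "- 4 \<noteq> (- 8::'a)" "- 1 \<noteq> (- 7::'a)" "- 1 \<noteq> (- 8::'a)" "- 7 \<noteq> (- 8::'a)"
      by (rule neI, simp add: nz)+
    then show ?thesis by auto
  qed
  ultimately show ?thesis unfolding nabla2_eq_card by (intro card_ge_4I[where u = "- 4" and v = "- 1" and w = "- 7" and x = "- 8"]) simp_all
qed

theorem theorem3p3:
  fixes p n :: nat and f :: "'a::{field,finite} \<Rightarrow> 'a"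
  defines "f \<equiv> inv_swap01"
  assumes "prime p" and "odd p" and "n > 0"
    and "card (UNIV :: 'a set) = p ^ n"
  shows "(if p = 29 \<or> p = 37 then nabla_unif f = 4
          else nabla_unif f \<le> 3)
    \<and> (\<forall>a b :: 'a. nabla2 f a b = 4 \<longleftrightarrow>
         (p = 29 \<and> (((a = 2 \<or> a = -2) \<and> (b = 12 \<or> b = -12)) \<or>
                     ((a = 12 \<or> a = -12) \<and> (b = 2 \<or> b = -2)))) \<or>
         (p = 37 \<and> (((a = 2 \<or> a = -2) \<and> (b = 6 \<or> b = -6)) \<or>
                     ((a = 6 \<or> a = -6) \<and> (b = 2 \<or> b = -2)))))"
proof -
  have char: "CHAR('a) = p" using CHAR_eq_of_card_eq_prime_power assms by blast
  note nz = numeral_eq_0_iff_CHAR_dvd[where 'a = 'a, unfolded char]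
  have p_dvd: "p dvd q \<longleftrightarrow> p = q" if "prime q" for q
    using that \<open>prime p\<close> primes_dvd_imp_eq by auto
  have two: "(2::'a) \<noteq> 0" using \<open>odd p\<close> p_dvd[of 2] by (auto simp: nz)
  have "prime (29::nat)" "prime (37::nat)" by simp_all
  then have 29: "(29::'a) = 0 \<longleftrightarrow> p = 29" and 37: "(37::'a) = 0 \<longleftrightarrow> p = 37"
    using p_dvd by (simp_all add: nz)
  have exceptional_iff: "exceptional a b \<longleftrightarrow>
      (p = 29 \<and> (((a = 2 \<or> a = -2) \<and> (b = 12 \<or> b = -12)) \<or>
                  ((a = 12 \<or> a = -12) \<and> (b = 2 \<or> b = -2)))) \<or>
      (p = 37 \<and> (((a = 2 \<or> a = -2) \<and> (b = 6 \<or> b = -6)) \<or>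
                  ((a = 6 \<or> a = -6) \<and> (b = 2 \<or> b = -2))))" for a b :: 'a
    unfolding exceptional_def 29 37 ..
  have le: "nabla2 f a b \<le> 3 \<or> nabla2 f a b = 4 \<and> exceptional a b" if "a \<noteq> 0" "b \<noteq> 0" for a b
    using nabla2_le_3_or_exceptional[OF two that] unfolding f_def .
  have ge: "4 \<le> nabla2 f a b" if "exceptional a b" for a b
  proof -
    have 4: "4 \<le> nabla2 f x y"
      if "p = 29 \<and> (x = 2 \<or> x = - 2) \<and> (y = 12 \<or> y = - 12) \<or>
        p = 37 \<and> (x = 2 \<or> x = - 2) \<and> (y = 6 \<or> y = - 6)" for x y
      using that nabla2_2_12_char_29[where 'a = 'a] nabla2_2_6_char_37[where 'a = 'a] char
      unfolding f_def by (elim disjE conjE) (simp_all only: nabla2_neg_left nabla2_neg_right)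
    from that 4[of a b] 4[of b a] nabla2_swap[of a b]
    show ?thesis unfolding exceptional_iff f_def by auto
  qed
  have nonzero: "a \<noteq> 0 \<and> b \<noteq> 0" if "exceptional a b" for a b :: 'a
    using that unfolding exceptional_iff by (auto simp: nz)
  \<comment> \<open>The equivalence also ranges over zero entries. There every element is a
    solution, and the count \<open>p ^ n\<close> is odd.\<close>
  have zero: "nabla2 f a b \<noteq> 4" if "a = 0 \<or> b = 0" for a b
  proof -
    have "nabla2 f a b = p ^ n"
      using that assms(5) unfolding nabla2_def by auto
    moreover have "odd (p ^ n)" using \<open>odd p\<close> by simp
    ultimately show ?thesis by (metis even_numeral)
  qed
  have iff: "nabla2 f a b = 4 \<longleftrightarrow> exceptional a b" for a b
  proof
    assume 4: "nabla2 f a b = 4"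
    then have "a \<noteq> 0" "b \<noteq> 0" using zero by auto
    then show "exceptional a b" using le[of a b] 4 by simp
  next
    assume "exceptional a b"
    then show "nabla2 f a b = 4" using ge[of a b] le[of a b] nonzero[of a b] by simp
  qed
  let ?V = "{nabla2 f a b | a b. a \<noteq> 0 \<and> b \<noteq> 0}"
  have "?V \<subseteq> (\<lambda>(a, b). nabla2 f a b) ` UNIV" by auto
  then have fin: "finite ?V" by (rule finite_subset) simp
  have "nabla2 f 1 1 \<in> ?V" by (intro CollectI exI[of _ 1] conjI refl one_neq_zero)
  then have ne: "?V \<noteq> {}" by (metis empty_iff)
  have "if p = 29 \<or> p = 37 then nabla_unif f = 4 else nabla_unif f \<le> 3"
  proof (cases "p = 29 \<or> p = 37")
    case True
    \<comment> \<open>The value 4 is attained at \<open>b = 12\<close> or \<open>b = 6\<close>,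
      according to the characteristic.\<close>
    then obtain b :: 'a where "exceptional 2 b" unfolding exceptional_iff by blast
    then have "nabla2 f 2 b = 4" "(2::'a) \<noteq> 0" "b \<noteq> 0" using iff nonzero by blast+
    then have "4 \<in> ?V" by (intro CollectI exI[of _ 2] exI[of _ b] conjI) simp_all
    moreover have "\<forall>v\<in>?V. v \<le> 4"
    proof
      fix v assume "v \<in> ?V"
      then obtain a b where "v = nabla2 f a b" "a \<noteq> 0" "b \<noteq> 0" by blast
      then show "v \<le> 4" using le[of a b] by linarith
    qed
    ultimately have "Max ?V = 4" using fin by (intro Max_eqI) auto
    then show ?thesis using True by (simp add: nabla_unif_def)
  next
    case False
    then have "\<forall>v\<in>?V. v \<le> 3" using le exceptional_iff by blast
    then show ?thesis using False fin ne by (simp add: nabla_unif_def)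
  qed
  then show ?thesis unfolding iff exceptional_iff by blast
qed

end
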